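(* There is an absolute constant $c>0$ such that for all integers $1\le k<n$ there exist $\boldsymbol\mu,\boldsymbol\nu\in\mathbb{R}_{\ge0}^n$ with $e_i(\boldsymbol\mu)=e_i(\boldsymbol\nu)$ for $i=1,\dots,k$ and \[\frac{\nu_{\max}}{\mu_{\max}}\ge 1+\frac{c}{k^2}.\]
   Context: For $\boldsymbol\mu\in\mathbb{R}^n$, $e_i(\boldsymbol\mu)=\sum_{T\subseteq[n],\,|T|=i}\prod_{j\in T}\mu_j$ is the $i$-th elementary symmetric polynomial of the coordinates, and $\mu_{\max}=\max_j\mu_j$ (similarly $\nu_{\max}$). *)

theory Defs
  imports Complex_Main
begin

text \<open>
  A vector in \<open>\<real>\<^sup>n\<close> is a function of type \<^typ>\<open>nat \<Rightarrow> real\<close> of which only the values at the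
  indices \<open>1, \<dots>, n\<close> matter, since \<open>n\<close> is quantified inside the statement.
\<close>

definition elem_sym :: "nat \<Rightarrow> nat \<Rightarrow> (nat \<Rightarrow> real) \<Rightarrow> real" where
  "elem_sym n i \<mu> = (\<Sum>T | T \<subseteq> {1..n} \<and> card T = i. \<Prod>j\<in>T. \<mu> j)"

definition vec_max :: "nat \<Rightarrow> (nat \<Rightarrow> real) \<Rightarrow> real" where
  "vec_max n \<mu> = Max (\<mu> ` {1..n})"

end

theory Submission
  imports Defs "HOL-Computational_Algebra.Polynomial" "HOL-Analysis.Complex_Transcendental"
begin

text \<open>
  With \<open>m = k + 1\<close>, the polynomials \<open>T\<^sub>m - 1\<close> and \<open>T\<^sub>m + 1\<close>, where \<open>T\<^sub>m\<close> is the Chebyshev polynomial,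
  differ by a constant, so the elementary symmetric polynomials of their roots agree up to
  degree \<open>k\<close>, also after translating the roots by 1 and appending zeros. All roots are real and lie
  in \<open>[-1, 1]\<close>; the largest ones are \<open>1\<close> and \<open>cos (\<pi>/m)\<close>. The ratio of the translated maxima
  is \<open>2 / (1 + cos (\<pi>/m)) = 1 + tan\<^sup>2 (\<pi>/(2m))\<close>.
\<close>

lemma prod_one_plus_scaled_eq_elem_sym:
  "(\<Prod>j=1..n. 1 + s * a j) = (\<Sum>i\<le>n. elem_sym n i a * s ^ i)"
proof -
  have "(\<Prod>j=1..n. 1 + s * a j) = (\<Sum>X\<in>Pow {1..n}. \<Prod>j\<in>X. s * a j)"
    using prod_add[of "{1..n}" "\<lambda>j. s * a j" "\<lambda>_. 1"] by (simp add: add.commute)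
  also have "\<dots> = (\<Sum>i\<le>n. \<Sum>X | X \<in> Pow {1..n} \<and> card X = i. \<Prod>j\<in>X. s * a j)"
    by (rule sum.group[symmetric]) (use card_mono[of "{1..n}"] in auto)
  also have "\<dots> = (\<Sum>i\<le>n. elem_sym n i a * s ^ i)"
    unfolding elem_sym_def sum_distrib_right
    by (intro sum.cong) (auto simp: prod.distrib)
  finally show ?thesis .
qed

text \<open>Both products are polynomials in \<open>s\<close> whose coefficients are the elementary
  symmetric polynomials. An identity at infinitely many \<open>s\<close> is one of coefficients, and
  the right-hand side touches only the coefficient of \<open>s ^ m\<close>.\<close>

lemma elem_sym_eq_if_prods_differ_by_power:
  fixes C :: real
  assumes inf: "infinite S" and "m \<le> n" and "i < m"
    and diff: "\<And>s. s \<in> S \<Longrightarrow> (\<Prod>j=1..n. 1 + s * a j) - (\<Prod>j=1..n. 1 + s * b j) = C * s ^ m"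
  shows "elem_sym n i a = elem_sym n i b"
proof -
  define c where "c l = elem_sym n l a - elem_sym n l b - (if l = m then C else 0)" for l
  have "(\<Sum>l\<le>n. c l * s ^ l) = 0" if "s \<in> S" for s
  proof -
    have "(\<Sum>l\<le>n. (if l = m then C else 0) * s ^ l) = C * s ^ m"
      using \<open>m \<le> n\<close> by (simp add: if_distrib[of "\<lambda>x. x * _"] sum.delta cong: if_cong)
    then show ?thesis
      using diff[OF that] unfolding prod_one_plus_scaled_eq_elem_sym
      by (simp add: c_def left_diff_distrib sum_subtractf)
  qed
  then have "S \<subseteq> {s. (\<Sum>l\<le>n. c l * s ^ l) = 0}"
    by blast
  with inf have "infinite {s. (\<Sum>l\<le>n. c l * s ^ l) = 0}"
    using finite_subset by blast
  then have "c i = 0"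
    using assms(2,3) by (simp add: polyfun_finite_roots)
  then show ?thesis
    using \<open>i < m\<close> by (simp add: c_def)
qed

text \<open>As polynomials in \<open>z\<close>, both sides are monic of degree \<open>m\<close> and
  vanish at the same \<open>m\<close> distinct points.\<close>

lemma prod_diff_rotated_roots_of_unity:
  fixes z w :: complex
  assumes "0 < m" and "w \<noteq> 0"
  shows "(\<Prod>j<m. z - w * cis (2 * pi * real j / real m)) = z ^ m - w ^ m"
proof -
  define r where "r j = w * cis (2 * pi * real j / real m)" for j
  define p where "p = (\<Prod>j<m. [:- r j, 1:])"
  define q where "q = monom 1 m - [:w ^ m:]"
  have inj: "inj_on r {..<m}"
    using Complex.bij_betw_roots_unity[OF \<open>0 < m\<close>] \<open>w \<noteq> 0\<close>
    by (auto simp: r_def bij_betw_def inj_on_def)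
  have deg: "degree p = m"
    unfolding p_def by (subst degree_prod_eq_sum_degree) auto
  have "lead_coeff p = 1"
    unfolding p_def by (simp add: lead_coeff_prod)
  have "p = q"
  proof (rule poly_eqI_degree_lead_coeff[where A = "r ` {..<m}" and n = m])
    show "coeff p m = coeff q m"
      using \<open>lead_coeff p = 1\<close> deg \<open>0 < m\<close> by (simp add: q_def coeff_pCons split: nat.split)
    show "m \<le> card (r ` {..<m})"
      by (simp add: card_image inj)
    show "degree q \<le> m"
      unfolding q_def by (intro degree_diff_le) (auto simp: degree_monom_le)
    show "poly p x = poly q x" if "x \<in> r ` {..<m}" for x
    proof -
      from that obtain j where j: "j < m" "x = r j" by auto
      have "cis (2 * pi * real j / real m) ^ m = 1"
        using bij_betwE[OF Complex.bij_betw_roots_unity[OF \<open>0 < m\<close>]] j by auto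
      then have "poly q x = 0"
        by (simp add: q_def poly_monom j r_def power_mult_distrib)
      moreover have "poly p x = 0"
        using j by (auto simp: p_def poly_prod)
      ultimately show ?thesis by simp
    qed
  qed (simp add: deg)
  then have "poly p z = poly q z" by simp
  then show ?thesis
    by (simp add: p_def q_def r_def poly_prod poly_monom)
qed

text \<open>For real \<open>z\<close>, each factor is the squared modulus of
  \<open>z - cis \<theta>\<close>, so the product is the squared modulus of
  \<open>z ^ m - cis (m * \<phi>)\<close>.\<close>

lemma prod_quadratics_cos:
  fixes z \<phi> :: real
  assumes "0 < m"
  shows "(\<Prod>j=1..m. z\<^sup>2 - 2 * z * cos (\<phi> + 2 * pi * real j / real m) + 1)
    = (z ^ m)\<^sup>2 - 2 * z ^ m * cos (real m * \<phi>) + 1"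
proof -
  \<comment> \<open>Reindexing from \<open>1..m\<close> to \<open>0..m-1\<close> moves one step into
    the phase; multiplied by \<open>m\<close>, that step is a full turn.\<close>
  define \<psi> where "\<psi> = \<phi> + 2 * pi / real m"
  define t where "t j = 2 * pi * real j / real m" for j
  have cis_factor: "complex_of_real (x\<^sup>2 - 2 * x * cos \<theta> + 1)
      = (complex_of_real x - cis \<theta>) * cnj (complex_of_real x - cis \<theta>)" for x \<theta>
    using sin_cos_squared_add[of \<theta>]
    by (simp add: complex_eq_iff power2_eq_square algebra_simps)
  have "(\<Prod>j=1..m. z\<^sup>2 - 2 * z * cos (\<phi> + 2 * pi * real j / real m) + 1)
      = (\<Prod>j<m. z\<^sup>2 - 2 * z * cos (\<psi> + t j) + 1)"
    unfolding One_nat_def prod.atLeast1_atMost_eq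
    by (simp add: \<psi>_def t_def distrib_left add_divide_distrib add.assoc)
  also have "complex_of_real \<dots>
      = (\<Prod>j<m. complex_of_real z - cis \<psi> * cis (t j)) *
        cnj (\<Prod>j<m. complex_of_real z - cis \<psi> * cis (t j))"
    unfolding of_real_prod cis_factor cis_mult[symmetric] by (simp add: prod.distrib)
  also have "\<dots> = (complex_of_real (z ^ m) - cis (real m * \<psi>)) *
        cnj (complex_of_real (z ^ m) - cis (real m * \<psi>))"
    using prod_diff_rotated_roots_of_unity[OF \<open>0 < m\<close>, of "cis \<psi>" "complex_of_real z"]
    by (simp add: t_def Complex.DeMoivre)
  also have "\<dots> = complex_of_real ((z ^ m)\<^sup>2 - 2 * z ^ m * cos (real m * \<psi>) + 1)"
    unfolding cis_factor ..
  also have "cos (real m * \<psi>) = cos (real m * \<phi>)"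
    using \<open>0 < m\<close> by (simp add: \<psi>_def distrib_left)
  finally show ?thesis
    unfolding of_real_eq_iff .
qed

text \<open>Here \<open>x = (z + 1/z) / 2\<close>, which reduces each factor to a quadratic in
  \<open>z\<close>. The first term on the right is the Chebyshev value
  \<open>T_m(x) / 2^(m-1)\<close>; the phase enters only through the second term, which is constant
  in \<open>x\<close>.\<close>

lemma prod_diff_cos:
  fixes x \<phi> :: real
  assumes "0 < m" and "1 \<le> x"
  defines "z \<equiv> x + sqrt (x\<^sup>2 - 1)"
  shows "(\<Prod>j=1..m. x - cos (\<phi> + 2 * pi * real j / real m))
    = ((z ^ m)\<^sup>2 + 1) / (2 * z) ^ m - 2 / 2 ^ m * cos (real m * \<phi>)"
proof -
  have "1 \<le> x\<^sup>2" using \<open>1 \<le> x\<close> by simp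
  then have "z > 0"
    using \<open>1 \<le> x\<close> by (simp add: z_def add_pos_nonneg)
  have "z\<^sup>2 + 1 = 2 * x * z"
    using \<open>1 \<le> x\<^sup>2\<close> by (simp add: z_def power2_sum algebra_simps) (simp add: power2_eq_square)
  then have "x - c = (z\<^sup>2 - 2 * z * c + 1) / (2 * z)" for c
    using \<open>z > 0\<close> by (simp add: field_simps)
  then have "(\<Prod>j=1..m. x - cos (\<phi> + 2 * pi * real j / real m))
      = ((z ^ m)\<^sup>2 - 2 * z ^ m * cos (real m * \<phi>) + 1) / (2 * z) ^ m"
    unfolding prod_quadratics_cos[OF \<open>0 < m\<close>, symmetric] by (simp add: prod_dividef)
  also have "\<dots> = ((z ^ m)\<^sup>2 + 1) / (2 * z) ^ m - 2 / 2 ^ m * cos (real m * \<phi>)"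
    using \<open>z > 0\<close> by (simp add: field_simps power_mult_distrib)
  finally show ?thesis .
qed

text \<open>The roots of \<open>T_m - cos (m * \<phi>)\<close> with multiplicity, translated by 1 to
  be nonnegative and padded with zeros. Phase 0 gives \<open>T_m - 1\<close>, phase
  \<open>- pi / m\<close> gives \<open>T_m + 1\<close>.\<close>

definition shifted_cos_nodes :: "nat \<Rightarrow> real \<Rightarrow> nat \<Rightarrow> real" where
  "shifted_cos_nodes m \<phi> j = (if j \<le> m then 1 + cos (\<phi> + 2 * pi * real j / real m) else 0)"

lemma shifted_cos_nodes_nonneg: "0 \<le> shifted_cos_nodes m \<phi> j"
proof -
  have "0 \<le> 1 + cos x" for x :: real
    using cos_ge_minus_one[of x] by linarith
  then show ?thesis unfolding shifted_cos_nodes_def by (simp split: if_split)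
qed

lemma elem_sym_shifted_cos_nodes_eq:
  assumes "i < m" and "m \<le> n"
  shows "elem_sym n i (shifted_cos_nodes m \<phi>) = elem_sym n i (shifted_cos_nodes m \<psi>)"
\<comment> \<open>With \<open>s = -1 / (1 + x)\<close>, the factor
  \<open>1 + s * (1 + cos t)\<close> equals \<open>- s * (x - cos t)\<close>, so a difference
  constant in \<open>x\<close> becomes a multiple of \<open>s ^ m\<close>.\<close>
proof (rule elem_sym_eq_if_prods_differ_by_power[where S = "(\<lambda>x::real. - 1 / (1 + x)) ` {1..}"])
  have "inj_on (\<lambda>x::real. - 1 / (1 + x)) {1..}"
    by (auto simp: inj_on_def)
  moreover have "infinite {1::real..}"
    by (rule infinite_Ici)
  ultimately show "infinite ((\<lambda>x::real. - 1 / (1 + x)) ` {1..})"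
    by (simp add: finite_image_iff)
next
  fix s :: real assume "s \<in> (\<lambda>x. - 1 / (1 + x)) ` {1..}"
  then obtain x where x: "1 \<le> x" "s = - 1 / (1 + x)" by auto
  have "0 < m" using \<open>i < m\<close> by simp
  have prod_eq: "(\<Prod>j=1..n. 1 + s * shifted_cos_nodes m \<theta> j)
      = (- s) ^ m * (\<Prod>j=1..m. x - cos (\<theta> + 2 * pi * real j / real m))" for \<theta>
  proof -
    have "(\<Prod>j=1..n. 1 + s * shifted_cos_nodes m \<theta> j)
        = (\<Prod>j=1..m. 1 + s * shifted_cos_nodes m \<theta> j)"
      using \<open>m \<le> n\<close> by (intro prod.mono_neutral_right) (auto simp: shifted_cos_nodes_def)
    also have "\<dots> = (\<Prod>j=1..m. - s * (x - cos (\<theta> + 2 * pi * real j / real m)))"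
      using x by (intro prod.cong) (auto simp: shifted_cos_nodes_def field_simps)
    finally show ?thesis
      by (simp only: prod.distrib prod_constant) simp
  qed
  show "(\<Prod>j=1..n. 1 + s * shifted_cos_nodes m \<phi> j) - (\<Prod>j=1..n. 1 + s * shifted_cos_nodes m \<psi> j)
      = ((- 1) ^ m * (2 / 2 ^ m) * (cos (real m * \<psi>) - cos (real m * \<phi>))) * s ^ m"
    unfolding prod_eq prod_diff_cos[OF \<open>0 < m\<close> x(1)] power_minus[of s]
    by (simp add: algebra_simps diff_divide_distrib)
qed (use assms in auto)

lemma vec_max_shifted_cos_nodes_ge:
  assumes "0 < m" and "m \<le> n"
  shows "2 \<le> vec_max n (shifted_cos_nodes m 0)"
proof -
  \<comment> \<open>At index \<open>m\<close> the angle is a full turn.\<close>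
  have "shifted_cos_nodes m 0 m = 2"
    using assms by (simp add: shifted_cos_nodes_def)
  then show ?thesis
    unfolding vec_max_def using assms by (intro Max_ge) (auto intro!: image_eqI[where x = m])
qed

lemma cos_le_cos_if_between:
  fixes a t :: real
  assumes "0 \<le> a" and "a \<le> pi" and "a \<le> t" and "t \<le> 2 * pi - a"
  shows "cos t \<le> cos a"
proof (cases "t \<le> pi")
  case True
  then show ?thesis using assms by (intro cos_monotone_0_pi_le) auto
next
  case False
  then have "cos (2 * pi - t) \<le> cos a" using assms by (intro cos_monotone_0_pi_le) auto
  then show ?thesis by (simp add: cos_diff)
qed

text \<open>The angles are the odd multiples \<open>(2j - 1) * pi / m\<close>, all between
  \<open>pi / m\<close> and \<open>2 * pi - pi / m\<close>; the first one attains the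
  maximum.\<close>

lemma vec_max_shifted_cos_nodes:
  assumes "0 < m" and "m \<le> n"
  shows "vec_max n (shifted_cos_nodes m (- pi / real m)) = 1 + cos (pi / real m)"
  unfolding vec_max_def
proof (rule Max_eqI)
  show "1 + cos (pi / real m) \<in> shifted_cos_nodes m (- pi / real m) ` {1..n}"
    using assms by (intro image_eqI[where x = 1]) (auto simp: shifted_cos_nodes_def field_simps)
next
  fix y assume "y \<in> shifted_cos_nodes m (- pi / real m) ` {1..n}"
  then obtain j where j: "1 \<le> j" and y: "y = shifted_cos_nodes m (- pi / real m) j"
    by auto
  show "y \<le> 1 + cos (pi / real m)"
  proof (cases "j \<le> m")
    case True
    have "cos (- pi / real m + 2 * pi * real j / real m) \<le> cos (pi / real m)"
      by (rule cos_le_cos_if_between) (use assms(1) j True in \<open>auto simp: field_simps\<close>)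
    then show ?thesis using True by (simp add: y shifted_cos_nodes_def)
  next
    case False
    then have "y = 0" by (simp add: y shifted_cos_nodes_def)
    with cos_ge_minus_one[of "pi / real m"] show ?thesis by linarith
  qed
qed simp

text \<open>By the double-angle formula the right-hand side is \<open>1 + tan^2 (x/2)\<close>, and
  the tangent dominates its argument on \<open>[0, pi/2)\<close>.\<close>

lemma two_div_one_plus_cos_ge:
  fixes x :: real
  assumes "0 \<le> x" and "x < pi"
  shows "1 + (x / 2)\<^sup>2 \<le> 2 / (1 + cos x)"
proof -
  have "cos (x / 2) > 0"
    using assms by (intro cos_gt_zero_pi) auto
  have "x / 2 \<le> tan (x / 2)"
    using assms abs_tan_ge[of "x / 2"] tan_gt_zero[of "x / 2"] by (cases "x = 0") auto
  then have "1 + (x / 2)\<^sup>2 \<le> 1 + (tan (x / 2))\<^sup>2"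
    using assms by (intro add_left_mono power_mono) auto
  also have "\<dots> = 2 / (1 + cos x)"
    using \<open>cos (x / 2) > 0\<close> cos_double_cos[of "x / 2"]
    by (simp add: tan_sec power_divide inverse_eq_divide)
  finally show ?thesis .
qed

theorem theorem3p7:
  "\<exists>c::real. c > 0 \<and>
    (\<forall>k n :: nat. 1 \<le> k \<and> k < n \<longrightarrow>
      (\<exists>\<mu> \<nu> :: nat \<Rightarrow> real.
        (\<forall>j\<in>{1..n}. 0 \<le> \<mu> j) \<and> (\<forall>j\<in>{1..n}. 0 \<le> \<nu> j) \<and>
        (\<forall>i\<in>{1..k}. elem_sym n i \<mu> = elem_sym n i \<nu>) \<and>
        vec_max n \<mu> > 0 \<and>
        vec_max n \<nu> / vec_max n \<mu> \<ge> 1 + c / (real k)\<^sup>2))"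
proof (intro exI[of _ "1 / 4"] conjI allI impI)
  fix k n :: nat
  assume kn: "1 \<le> k \<and> k < n"
  \<comment> \<open>Agreement holds in degrees below \<open>m\<close>, hence up to \<open>k\<close>;
    \<open>k < n\<close> leaves room for \<open>m\<close> nodes.\<close>
  define m where "m = Suc k"
  define \<mu> where "\<mu> = shifted_cos_nodes m (- pi / real m)"
  define \<nu> where "\<nu> = shifted_cos_nodes m 0"
  have m: "0 < m" "m \<le> n" "2 \<le> m" using kn by (auto simp: m_def)
  have max_\<mu>: "vec_max n \<mu> = 1 + cos (pi / real m)"
    unfolding \<mu>_def using m by (intro vec_max_shifted_cos_nodes)
  have "pi / real m \<le> pi / 2"
    using m by (intro divide_left_mono) auto
  then have "0 \<le> cos (pi / real m)"
    using m by (intro cos_ge_zero) (auto intro: order_trans[of _ 0])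
  then have pos: "vec_max n \<mu> > 0" by (simp add: max_\<mu>)
  \<comment> \<open>Squaring this yields the constant \<open>1 / 4\<close>; it rests on
    \<open>k + 1 \<le> 2 * k\<close> and \<open>2 \<le> pi\<close>.\<close>
  have "1 / (2 * real k) \<le> pi / real m / 2"
  proof -
    have "real m \<le> 2 * real k" using kn by (simp add: m_def)
    also have "\<dots> \<le> pi * real k" using pi_ge_two by (intro mult_right_mono) auto
    finally show ?thesis using m kn by (simp add: field_simps)
  qed
  then have "(1 / (2 * real k))\<^sup>2 \<le> (pi / real m / 2)\<^sup>2"
    by (intro power_mono) auto
  then have "1 + 1 / 4 / (real k)\<^sup>2 \<le> 1 + (pi / real m / 2)\<^sup>2"
    by (simp add: power_divide power_mult_distrib)
  also have "\<dots> \<le> 2 / (1 + cos (pi / real m))"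
    using m by (intro two_div_one_plus_cos_ge) (auto simp: field_simps)
  also have "\<dots> \<le> vec_max n \<nu> / vec_max n \<mu>"
    using pos m vec_max_shifted_cos_nodes_ge[of m n]
    by (simp add: max_\<mu> \<nu>_def divide_right_mono)
  finally have ratio: "1 + 1 / 4 / (real k)\<^sup>2 \<le> vec_max n \<nu> / vec_max n \<mu>" .
  have "elem_sym n i \<mu> = elem_sym n i \<nu>" if "i \<in> {1..k}" for i
    unfolding \<mu>_def \<nu>_def
    using that m by (intro elem_sym_shifted_cos_nodes_eq) (auto simp: m_def)
  then show "\<exists>\<mu> \<nu> :: nat \<Rightarrow> real.
        (\<forall>j\<in>{1..n}. 0 \<le> \<mu> j) \<and> (\<forall>j\<in>{1..n}. 0 \<le> \<nu> j) \<and>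
        (\<forall>i\<in>{1..k}. elem_sym n i \<mu> = elem_sym n i \<nu>) \<and>
        vec_max n \<mu> > 0 \<and>
        vec_max n \<nu> / vec_max n \<mu> \<ge> 1 + 1 / 4 / (real k)\<^sup>2"
    using ratio pos
    by (intro exI[of _ \<mu>] exI[of _ \<nu>]) (auto simp: \<mu>_def \<nu>_def shifted_cos_nodes_nonneg)
qed simp

end
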